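(* Let $\Psi$ be a $\mathsf{Max\text{-}2OR}$ instance with $m_1$ 1-clauses and $m_2$ 2-clauses. Then (1) $\mathrm{val}_\Psi\ge\dfrac{m_1+m_2+\mathrm{bias}(\Psi)}{2}$; (2) if $m_2>0$ and $\mathrm{bias}(\Psi)\le m_2$, then $$\mathrm{val}_\Psi\ \ge\ \frac{m_1}{2}+\frac{3m_2}{4}+\frac{\mathrm{bias}(\Psi)^2}{4m_2}.$$
   Context: A $\mathsf{Max\text{-}2OR}$ instance $\Psi$ consists of Boolean variables $x_1,\dots,x_n$ and a list of clauses, each being either a 1-clause (a single literal $x_i$ or $\neg x_i$) or a 2-clause (a disjunction of two literals of two distinct variables); clauses with two identical literals are regarded as 1-clauses, and there are no tautological clauses. $\mathrm{val}_\Psi$ is the maximum over all assignments of the number of satisfied clauses. For $r\in\{1,2\}$, $\mathrm{pos}^{(r)}_i(\Psi)$ and $\mathrm{neg}^{(r)}_i(\Psi)$ denote the numbers of $r$-clauses containing the literal $x_i$, respectively $\neg x_i$. The bias is $$\mathrm{bias}(\Psi)=\frac12\sum_{i=1}^n\left|2\,\mathrm{pos}^{(1)}_i(\Psi)+\mathrm{pos}^{(2)}_i(\Psi)-2\,\mathrm{neg}^{(1)}_i(\Psi)-\mathrm{neg}^{(2)}_i(\Psi)\right|.$$ *)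

theory Defs
  imports Complex_Main "HOL-Library.FuncSet"
begin

datatype literal = Pos (var_of: nat) | Neg (var_of: nat)

(* A clause is the set of its literals, read disjunctively. Hence a disjunction of two
   identical literals is a 1-clause, and the order of the two literals is immaterial. *)
type_synonym clause = "literal set"

(* The variables are x_1, ..., x_n with n = num_vars. The clauses form a list, so that
   the same clause may occur several times. *)
record max2or =
  num_vars :: nat
  clauses :: "clause list"

(* Injectivity of var_of excludes tautologies: the two literals of a 2-clause belong to
   distinct variables. *)
definition is_clause :: "nat \<Rightarrow> clause \<Rightarrow> bool" where
  "is_clause n C \<longleftrightarrow> card C \<in> {1, 2} \<and> var_of ` C \<subseteq> {1..n} \<and> inj_on var_of C"

definition max2or_instance :: "max2or \<Rightarrow> bool" where
  "max2or_instance \<Psi> \<longleftrightarrow> (\<forall>C \<in> set (clauses \<Psi>). is_clause (num_vars \<Psi>) C)"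

definition num_clauses :: "nat \<Rightarrow> max2or \<Rightarrow> nat" where
  "num_clauses r \<Psi> = length (filter (\<lambda>C. card C = r) (clauses \<Psi>))"

fun sat_literal :: "(nat \<Rightarrow> bool) \<Rightarrow> literal \<Rightarrow> bool" where
  "sat_literal a (Pos i) \<longleftrightarrow> a i"
| "sat_literal a (Neg i) \<longleftrightarrow> \<not> a i"

definition sat_clause :: "(nat \<Rightarrow> bool) \<Rightarrow> clause \<Rightarrow> bool" where
  "sat_clause a C \<longleftrightarrow> (\<exists>l \<in> C. sat_literal a l)"

definition num_sat :: "max2or \<Rightarrow> (nat \<Rightarrow> bool) \<Rightarrow> nat" where
  "num_sat \<Psi> a = length (filter (sat_clause a) (clauses \<Psi>))"

definition assignments :: "max2or \<Rightarrow> (nat \<Rightarrow> bool) set" where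
  "assignments \<Psi> = ({1..num_vars \<Psi>} \<rightarrow>\<^sub>E (UNIV :: bool set))"

definition val :: "max2or \<Rightarrow> nat" where
  "val \<Psi> = Max (num_sat \<Psi> ` assignments \<Psi>)"

definition pos :: "nat \<Rightarrow> nat \<Rightarrow> max2or \<Rightarrow> nat" where
  "pos r i \<Psi> = length (filter (\<lambda>C. card C = r \<and> Pos i \<in> C) (clauses \<Psi>))"

definition neg :: "nat \<Rightarrow> nat \<Rightarrow> max2or \<Rightarrow> nat" where
  "neg r i \<Psi> = length (filter (\<lambda>C. card C = r \<and> Neg i \<in> C) (clauses \<Psi>))"

definition bias :: "max2or \<Rightarrow> real" where
  "bias \<Psi> = 1 / 2 * (\<Sum>i = 1..num_vars \<Psi>.
     \<bar>2 * real (pos 1 i \<Psi>) + real (pos 2 i \<Psi>)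
      - 2 * real (neg 1 i \<Psi>) - real (neg 2 i \<Psi>)\<bar>)"

end

theory Submission
  imports Defs
begin

text \<open>Set every variable independently to its majority value with probability
  \<open>(1 + e) / 2\<close>, where \<open>0 \<le> e \<le> 1\<close>. A literal whose sign relative to the majority value
  is \<open>s\<close> then holds with probability \<open>(1 + e s) / 2\<close>, so a 1-clause holds with probability
  \<open>1/2 + e s / 2\<close> and a 2-clause with probability
  \<open>3/4 + e (s + s') / 4 - e\<^sup>2 s s' / 4\<close>. Summing the signs gives the bias, hence the expected
  number of satisfied clauses is at least \<open>m1/2 + 3 m2/4 + e bias / 2 - e\<^sup>2 m2 / 4\<close>. The choices
  \<open>e = 1\<close> and \<open>e = bias / m2\<close> give the two bounds. Instead of a probability space we use that the
  expectation is affine in each single probability, so that all probabilities can be rounded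
  to 0 or 1 without decreasing it.\<close>

section \<open>Satisfaction probabilities of clauses\<close>

fun literal_prob :: "(nat \<Rightarrow> real) \<Rightarrow> literal \<Rightarrow> real" where
  "literal_prob q (Pos i) = q i"
| "literal_prob q (Neg i) = 1 - q i"

text \<open>The product is the probability that all literals fail. Reading it this way relies on
  independence, so the literals must belong to distinct variables.\<close>

definition clause_prob :: "(nat \<Rightarrow> real) \<Rightarrow> clause \<Rightarrow> real" where
  "clause_prob q C = 1 - (\<Prod>l\<in>C. 1 - literal_prob q l)"

lemma literal_prob_fun_upd_other:
  "var_of l \<noteq> i \<Longrightarrow> literal_prob (q(i := x)) l = literal_prob q l"
  by (cases l) auto

text \<open>By injectivity at most one literal of \<open>C\<close> mentions \<open>i\<close>, so
  \<open>q i\<close> enters at most one factor of the product, and that factor is affine in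
  it.\<close>

lemma clause_prob_affine:
  assumes "finite C" "inj_on var_of C"
  shows "clause_prob q C =
    q i * clause_prob (q(i := 1)) C + (1 - q i) * clause_prob (q(i := 0)) C"
proof (cases "\<exists>l\<in>C. var_of l = i")
  case True
  then obtain l where l: "l \<in> C" "var_of l = i" by blast
  define P where "P = (\<Prod>l'\<in>C - {l}. 1 - literal_prob q l')"
  have "literal_prob (q(i := x)) l' = literal_prob q l'" if "l' \<in> C - {l}" for l' x
    using that l assms(2) by (intro literal_prob_fun_upd_other) (auto dest: inj_onD)
  then have upd: "clause_prob (q(i := x)) C = 1 - (1 - literal_prob (q(i := x)) l) * P" for x
    unfolding clause_prob_def P_def
    by (subst prod.remove[OF assms(1) l(1)]) simp
  \<comment> \<open>The instance \<open>x = q i\<close> leaves \<open>q\<close> unchanged.\<close>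
  have "clause_prob q C = 1 - (1 - literal_prob q l) * P"
    using upd[of "q i"] by simp
  with l(2) show ?thesis
    unfolding upd by (cases l) (auto simp: algebra_simps)
next
  case False
  then have "clause_prob (q(i := x)) C = clause_prob q C" for x
    by (auto simp: clause_prob_def literal_prob_fun_upd_other intro!: prod.cong)
  then show ?thesis by (simp add: algebra_simps)
qed

lemma clause_prob_of_bool:
  assumes "finite C" "\<And>i. i \<in> var_of ` C \<Longrightarrow> q i = of_bool (a i)"
  shows "clause_prob q C = of_bool (sat_clause a C)"
proof -
  have "1 - literal_prob q l = of_bool (\<not> sat_literal a l)" if "l \<in> C" for l
    using assms(2)[OF imageI[OF that]] by (cases l) auto
  then have "clause_prob q C = 1 - (\<Prod>l\<in>C. of_bool (\<not> sat_literal a l))"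
    by (simp add: clause_prob_def)
  then show ?thesis
    using assms(1) by (auto simp: sat_clause_def prod_zero_iff)
qed

section \<open>Rounding probabilities to an assignment\<close>

text \<open>One coordinate is rounded at a time: for \<open>q i\<close> in [0,1] the affine identity
  is a convex combination, so one of the two endpoint values is at least \<open>f q\<close>.\<close>

lemma multiaffine_rounding:
  fixes f :: "('a \<Rightarrow> real) \<Rightarrow> real"
  assumes affine: "\<And>q i. f q = q i * f (q(i := 1)) + (1 - q i) * f (q(i := 0))"
    and "finite V" "\<And>i. i \<in> V \<Longrightarrow> q i \<in> {0..1}"
  shows "\<exists>q'. (\<forall>i\<in>V. q' i \<in> {0, 1}) \<and> f q \<le> f q'"
proof -
  \<comment> \<open>Agreement with \<open>q\<close> off \<open>V\<close> is added for the induction: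
    the next coordinate to be rounded must still lie in [0,1].\<close>
  have "\<exists>q'. (\<forall>i\<in>V. q' i \<in> {0, 1}) \<and> (\<forall>i. i \<notin> V \<longrightarrow> q' i = q i) \<and> f q \<le> f q'"
    using assms(2,3)
  proof (induction V)
    case (insert j V)
    then obtain q' where q': "\<forall>i\<in>V. q' i \<in> {0, 1}" "\<forall>i. i \<notin> V \<longrightarrow> q' i = q i" "f q \<le> f q'"
      by auto
    have "0 \<le> q' j" "q' j \<le> 1"
      using insert q' by auto
    then have "f q' \<le> max (f (q'(j := 1))) (f (q'(j := 0)))"
      using convex_bound_le[of "f (q'(j := 1))" _ "f (q'(j := 0))" "q' j" "1 - q' j"]
      by (subst affine[of q' j]) auto
    then obtain x where x: "x \<in> {0, 1}" "f q' \<le> f (q'(j := x))"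
      by (auto simp: le_max_iff_disj)
    have "\<forall>i\<in>insert j V. (q'(j := x)) i \<in> {0, 1}"
      using q'(1) x(1) by auto
    moreover have "\<forall>i. i \<notin> insert j V \<longrightarrow> (q'(j := x)) i = q i"
      using q'(2) by auto
    moreover have "f q \<le> f (q'(j := x))"
      using q'(3) x(2) by linarith
    ultimately show ?case
      by (intro exI[of _ "q'(j := x)"] conjI)
  qed auto
  then show ?thesis by blast
qed

lemma length_filter_eq_sum_list:
  "real (length (filter P xs)) = (\<Sum>x\<leftarrow>xs. of_bool (P x))"
  by (induction xs) auto

lemma is_clause_finite: "is_clause n C \<Longrightarrow> finite C"
  unfolding is_clause_def by (auto intro: card_ge_0_finite)

lemma sum_clause_prob_le_val:
  assumes inst: "max2or_instance \<Psi>" and q: "\<And>i. i \<in> {1..num_vars \<Psi>} \<Longrightarrow> q i \<in> {0..1}"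
  shows "(\<Sum>C\<leftarrow>clauses \<Psi>. clause_prob q C) \<le> real (val \<Psi>)"
proof -
  define f where "f q = (\<Sum>C\<leftarrow>clauses \<Psi>. clause_prob q C)" for q
  have clause: "is_clause (num_vars \<Psi>) C" if "C \<in> set (clauses \<Psi>)" for C
    using inst that by (auto simp: max2or_instance_def)
  have "f q = q i * f (q(i := 1)) + (1 - q i) * f (q(i := 0))" for q i
    unfolding f_def sum_list_const_mult[symmetric] sum_list_addf[symmetric]
    using clause
    by (intro arg_cong[where f = sum_list] map_cong refl clause_prob_affine is_clause_finite)
       (auto simp: is_clause_def)
  then obtain q' where q': "\<forall>i\<in>{1..num_vars \<Psi>}. q' i \<in> {0, 1}" "f q \<le> f q'"
    using multiaffine_rounding[of f "{1..num_vars \<Psi>}" q] q by auto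
  \<comment> \<open>\<open>assignments\<close> consists of extensional functions, hence
    \<open>restrict\<close>. Clauses mention only variables in the given range.\<close>
  define a where "a = restrict (\<lambda>i. q' i = 1) {1..num_vars \<Psi>}"
  have "f q' = (\<Sum>C\<leftarrow>clauses \<Psi>. of_bool (sat_clause a C))"
    unfolding f_def
  proof (intro arg_cong[where f = sum_list] map_cong refl clause_prob_of_bool)
    fix C i assume "C \<in> set (clauses \<Psi>)" "i \<in> var_of ` C"
    then have "i \<in> {1..num_vars \<Psi>}"
      using clause[of C] unfolding is_clause_def by blast
    then show "q' i = of_bool (a i)"
      using q'(1) by (auto simp: a_def)
  qed (use clause is_clause_finite in blast)
  also have "\<dots> = real (num_sat \<Psi> a)"
    by (simp add: num_sat_def length_filter_eq_sum_list)
  also have "num_sat \<Psi> a \<le> val \<Psi>"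
    unfolding val_def
    by (intro Max_ge finite_imageI imageI) (auto simp: assignments_def a_def intro: finite_PiE)
  finally show ?thesis
    using q'(2) by (simp add: f_def)
qed

section \<open>The bias as a sum over clauses\<close>

fun literal_sign :: "(nat \<Rightarrow> real) \<Rightarrow> literal \<Rightarrow> real" where
  "literal_sign \<sigma> (Pos i) = \<sigma> i"
| "literal_sign \<sigma> (Neg i) = - \<sigma> i"

text \<open>Passes from literals to variables, the index set of the bias. Inserting a new literal
  changes a single indicator, at its own variable.\<close>

lemma sum_literal_sign:
  assumes "finite C" "finite V" "var_of ` C \<subseteq> V"
  shows "(\<Sum>l\<in>C. literal_sign \<sigma> l) =
    (\<Sum>i\<in>V. \<sigma> i * (of_bool (Pos i \<in> C) - of_bool (Neg i \<in> C)))"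
  using assms(1,3)
proof (induction C)
  case (insert l C)
  have "(\<Sum>i\<in>V. \<sigma> i * (of_bool (Pos i \<in> insert l C) - of_bool (Neg i \<in> insert l C)))
    = (\<Sum>i\<in>V. (if i = var_of l then literal_sign \<sigma> l else 0)
        + \<sigma> i * (of_bool (Pos i \<in> C) - of_bool (Neg i \<in> C)))"
    using insert.hyps by (intro sum.cong refl, cases l) auto
  then show ?case
    using insert assms(2) by (simp add: sum.distrib)
qed simp

text \<open>Multiplication by this sign, 1 for a tie, produces the absolute values in
  \<open>bias\<close>.\<close>

definition majority :: "max2or \<Rightarrow> nat \<Rightarrow> real" where
  "majority \<Psi> i = (if 2 * real (pos 1 i \<Psi>) + real (pos 2 i \<Psi>)
      - 2 * real (neg 1 i \<Psi>) - real (neg 2 i \<Psi>) \<ge> 0 then 1 else - 1)"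

text \<open>The coefficients 2 and 1 from the bias. Times \<open>e / 4\<close> they are the
  coefficients of the signs in the clause probabilities.\<close>

definition clause_weight :: "clause \<Rightarrow> real" where
  "clause_weight C = 2 * of_bool (card C = 1) + of_bool (card C = 2)"

lemma sum_mult_sum_list_swap:
  fixes c :: "'a \<Rightarrow> 'b::semiring_0"
  shows "(\<Sum>i\<in>V. c i * (\<Sum>x\<leftarrow>xs. g i x)) = (\<Sum>x\<leftarrow>xs. \<Sum>i\<in>V. c i * g i x)"
  by (induction xs) (simp_all add: distrib_left sum.distrib)

lemma bias_eq_sum_list:
  assumes "max2or_instance \<Psi>"
  shows "bias \<Psi> = 1 / 2 * (\<Sum>C\<leftarrow>clauses \<Psi>.
    clause_weight C * (\<Sum>l\<in>C. literal_sign (majority \<Psi>) l))"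
proof -
  let ?V = "{1..num_vars \<Psi>}"
  have diff: "2 * real (pos 1 i \<Psi>) + real (pos 2 i \<Psi>)
      - 2 * real (neg 1 i \<Psi>) - real (neg 2 i \<Psi>)
      = (\<Sum>C\<leftarrow>clauses \<Psi>. clause_weight C * (of_bool (Pos i \<in> C) - of_bool (Neg i \<in> C)))" for i
    unfolding pos_def neg_def length_filter_eq_sum_list clause_weight_def
      sum_list_const_mult[symmetric] sum_list_addf[symmetric] sum_list_subtractf[symmetric]
    by (intro arg_cong[where f = sum_list] map_cong refl) auto
  have "bias \<Psi> = 1 / 2 * (\<Sum>i\<in>?V. majority \<Psi> i * (\<Sum>C\<leftarrow>clauses \<Psi>.
      clause_weight C * (of_bool (Pos i \<in> C) - of_bool (Neg i \<in> C))))"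
    unfolding bias_def diff[symmetric]
    by (intro arg_cong[where f = "\<lambda>x. 1 / 2 * x"] sum.cong refl) (auto simp: majority_def)
  also have "\<dots> = 1 / 2 * (\<Sum>C\<leftarrow>clauses \<Psi>. \<Sum>i\<in>?V.
      majority \<Psi> i * (clause_weight C * (of_bool (Pos i \<in> C) - of_bool (Neg i \<in> C))))"
    by (simp only: sum_mult_sum_list_swap)
  also have "\<dots> = 1 / 2 * (\<Sum>C\<leftarrow>clauses \<Psi>.
      clause_weight C * (\<Sum>l\<in>C. literal_sign (majority \<Psi>) l))"
  proof (intro arg_cong[where f = "\<lambda>xs. 1 / 2 * sum_list xs"] map_cong refl)
    fix C assume "C \<in> set (clauses \<Psi>)"
    then have "is_clause (num_vars \<Psi>) C"
      using assms by (auto simp: max2or_instance_def)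
    then have "finite C" "var_of ` C \<subseteq> ?V"
      by (blast intro: is_clause_finite, simp add: is_clause_def)
    then have "(\<Sum>l\<in>C. literal_sign (majority \<Psi>) l) =
        (\<Sum>i\<in>?V. majority \<Psi> i * (of_bool (Pos i \<in> C) - of_bool (Neg i \<in> C)))"
      by (intro sum_literal_sign finite_atLeastAtMost)
    then show "(\<Sum>i\<in>?V. majority \<Psi> i *
          (clause_weight C * (of_bool (Pos i \<in> C) - of_bool (Neg i \<in> C)))) =
        clause_weight C * (\<Sum>l\<in>C. literal_sign (majority \<Psi>) l)"
      by (simp only: sum_distrib_left mult.left_commute)
  qed
  finally show ?thesis .
qed

section \<open>The expected number of satisfied clauses\<close>

text \<open>Both sides agree for a 1-clause. For a 2-clause with signs \<open>s\<close> and
  \<open>s'\<close> they differ by \<open>e\<^sup>2 (1 - s s') / 4\<close>, which is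
  nonnegative.\<close>

lemma clause_prob_ge:
  assumes "card C \<in> {1, 2}" and \<sigma>: "\<And>i. \<bar>\<sigma> i\<bar> \<le> 1"
  shows "clause_prob (\<lambda>i. (1 + e * \<sigma> i) / 2) C \<ge>
    1 / 2 * of_bool (card C = 1) + (3 / 4 - e\<^sup>2 / 4) * of_bool (card C = 2)
    + e / 4 * (clause_weight C * (\<Sum>l\<in>C. literal_sign \<sigma> l))"
proof -
  have prob: "literal_prob (\<lambda>i. (1 + e * \<sigma> i) / 2) l = (1 + e * literal_sign \<sigma> l) / 2" for l
    by (cases l) (auto simp: field_simps)
  have sign: "\<bar>literal_sign \<sigma> l\<bar> \<le> 1" for l
    using \<sigma> by (cases l) auto
  consider l where "C = {l}" | l l' where "C = {l, l'}" "l \<noteq> l'"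
    using assms(1) by (auto simp: card_1_singleton_iff card_2_iff)
  then show ?thesis
  proof cases
    case 1
    then show ?thesis
      by (simp add: clause_prob_def prob clause_weight_def field_simps)
  next
    case 2
    have "literal_sign \<sigma> l * literal_sign \<sigma> l' \<le> 1"
      using mult_mono[OF sign[of l] sign[of l']] by (simp add: abs_mult[symmetric])
    then have "e\<^sup>2 * (literal_sign \<sigma> l * literal_sign \<sigma> l') \<le> e\<^sup>2"
      by (simp add: mult_left_le)
    then show ?thesis
      using 2 by (simp add: clause_prob_def prob clause_weight_def field_simps power2_eq_square)
  qed
qed

lemma val_ge:
  assumes inst: "max2or_instance \<Psi>" and e: "0 \<le> e" "e \<le> 1"
  shows "real (val \<Psi>) \<ge> real (num_clauses 1 \<Psi>) / 2 + (3 / 4 - e\<^sup>2 / 4) * real (num_clauses 2 \<Psi>)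
    + e / 2 * bias \<Psi>"
proof -
  \<comment> \<open>The factor 1/2 in \<open>bias\<close> turns \<open>e / 4\<close> into
    \<open>e / 2\<close>.\<close>
  have "real (num_clauses 1 \<Psi>) / 2 + (3 / 4 - e\<^sup>2 / 4) * real (num_clauses 2 \<Psi>)
      + e / 2 * bias \<Psi> =
    (\<Sum>C\<leftarrow>clauses \<Psi>. 1 / 2 * of_bool (card C = 1) + (3 / 4 - e\<^sup>2 / 4) * of_bool (card C = 2)
      + e / 4 * (clause_weight C * (\<Sum>l\<in>C. literal_sign (majority \<Psi>) l)))"
    unfolding num_clauses_def length_filter_eq_sum_list bias_eq_sum_list[OF inst]
      sum_list_addf sum_list_const_mult
    by simp
  also have "\<dots> \<le> (\<Sum>C\<leftarrow>clauses \<Psi>. clause_prob (\<lambda>i. (1 + e * majority \<Psi> i) / 2) C)"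
    using inst
    by (intro sum_list_mono clause_prob_ge)
       (auto simp: max2or_instance_def is_clause_def majority_def)
  also have "\<dots> \<le> real (val \<Psi>)"
    using e by (intro sum_clause_prob_le_val inst) (auto simp: majority_def)
  finally show ?thesis .
qed

theorem lemma3p7:
  fixes \<Psi> :: max2or and m1 m2 :: nat
  assumes "max2or_instance \<Psi>"
    and "m1 = num_clauses 1 \<Psi>"
    and "m2 = num_clauses 2 \<Psi>"
  shows "real (val \<Psi>) \<ge> (real m1 + real m2 + bias \<Psi>) / 2 \<and>
    (m2 > 0 \<and> bias \<Psi> \<le> real m2 \<longrightarrow>
      real (val \<Psi>) \<ge> real m1 / 2 + 3 * real m2 / 4 + (bias \<Psi>)\<^sup>2 / (4 * real m2))"
proof (intro conjI impI)
  show "real (val \<Psi>) \<ge> (real m1 + real m2 + bias \<Psi>) / 2"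
    \<comment> \<open>With \<open>e = 1\<close> every variable takes its majority value, and a
      2-clause contributes 3/4 - 1/4 = 1/2.\<close>
    using val_ge[OF assms(1), of 1] by (simp add: assms(2,3) field_simps)
next
  assume m2: "m2 > 0 \<and> bias \<Psi> \<le> real m2"
  \<comment> \<open>The choice \<open>e = bias \<Psi> / m2\<close> maximizes the quadratic
    \<open>e / 2 * bias \<Psi> - e\<^sup>2 / 4 * m2\<close>; it lies in [0,1] because 0 \<le>
    \<open>bias \<Psi>\<close> \<le> \<open>m2\<close>.\<close>
  have "bias \<Psi> \<ge> 0"
    unfolding bias_def by (intro mult_nonneg_nonneg sum_nonneg) auto
  then have "real (val \<Psi>) \<ge> real m1 / 2 + (3 / 4 - (bias \<Psi> / m2)\<^sup>2 / 4) * real m2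
      + (bias \<Psi> / m2) / 2 * bias \<Psi>"
    using val_ge[OF assms(1), of "bias \<Psi> / m2"] m2 by (simp add: assms(2,3))
  also have "real m1 / 2 + (3 / 4 - (bias \<Psi> / m2)\<^sup>2 / 4) * real m2
      + (bias \<Psi> / m2) / 2 * bias \<Psi> =
      real m1 / 2 + 3 * real m2 / 4 + (bias \<Psi>)\<^sup>2 / (4 * real m2)"
    using m2 by (simp add: field_simps power2_eq_square)
  finally show "real (val \<Psi>) \<ge> real m1 / 2 + 3 * real m2 / 4 + (bias \<Psi>)\<^sup>2 / (4 * real m2)" .
qed

end
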